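(* Consider the switched system $\dot x(t)=f_{\sigma(t)}(x(t),v(t))$, $y(t)=h_{\sigma(t)}(x(t))$, $x(0)=x_0$, $t\ge 0$, generated by a finite family of subsystems indexed by $\mathcal P=\mathcal P_S\sqcup\mathcal P_U$, with set of admissible switches $E(\mathcal P)$ and admissible minimum and maximum dwell times $0<\delta\le\Delta$ (see context). Suppose that: (A1) There exist class $\mathcal K_\infty$ functions $\underline\alpha,\overline\alpha,\gamma_1,\gamma_2$, continuously differentiable functions $V_p:\mathbb R^d\to[0,+\infty[$, $p\in\mathcal P$, and constants $\lambda_s,\lambda_u>0$ such that for all $\xi\in\mathbb R^d$ and $\eta\in\mathbb R^m$: $\underline\alpha(\|\xi\|)\le V_p(\xi)\le\overline\alpha(\|\xi\|)$ for all $p\in\mathcal P$; $\frac{\partial V_p}{\partial\xi}(\xi)f_p(\xi,\eta)\le-\lambda_sV_p(\xi)+\gamma_1(\|\eta\|)+\gamma_2(\|h_p(\xi)\|)$ for all $p\in\mathcal P_S$; $\frac{\partial V_p}{\partial\xi}(\xi)f_p(\xi,\eta)\le\lambda_uV_p(\xi)+\gamma_1(\|\eta\|)+\gamma_2(\|h_p(\xi)\|)$ for all $p\in\mathcal P_U$. (A2) There exists $\mu\ge1$ such that $V_q(\xi)\le\mu V_p(\xi)$ for all $\xi\in\mathbb R^d$ and all $(p,q)\in E(\mathcal P)$. (A3) For every $p\in\mathcal P_U$ there exists $q\in\mathcal P_S$ such that $(p,q)\in E(\mathcal P)$. (A4) There exist scalars $\check\delta,\hat\Delta\in[\delta,\Delta]$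 such that $$-\lambda_s\frac{\check\delta}{\Delta}+\lambda_s\frac{\check\delta}{2\delta}+\lambda_u\frac{\hat\Delta}{2\delta}+(\ln\mu)\frac1\delta<0 .$$ Then the switched system is input/output-to-state stable (IOSS) under every switching signal $\sigma\in\mathcal S'_{\mathcal R}$, where $\mathcal S'_{\mathcal R}$ is the set of switching signals defined in the context using these $\check\delta,\hat\Delta$.
   Context: Setting. $\mathcal P=\{1,\dots,N\}$ is a finite index set, partitioned as $\mathcal P=\mathcal P_S\sqcup\mathcal P_U$ (indices of "stable", i.e. IOSS, and "unstable" subsystems). For each $p\in\mathcal P$, $f_p:\mathbb R^d\times\mathbb R^m\to\mathbb R^d$ is locally Lipschitz with $f_p(0,0)=0$, and $h_p:\mathbb R^d\to\mathbb R^k$ is continuous with $h_p(0)=0$. Inputs $v:[0,\infty[\to\mathbb R^m$ are Lebesgue measurable and essentially bounded. $\|\cdot\|$ is the Euclidean norm and, for an interval $I\subseteq[0,\infty[$, $\|\cdot\|_I$ is the essential supremum norm on $I$. A switching signal is a piecewise constant function $\sigma:[0,+\infty[\to\mathcal P$, right-continuous with left limits everywhere; its switching instants (points where it jumps) are $0=:\tau_0<\tau_1<\tau_2<\cdots$. Solutions are in the Carathéodory sense. $E(\mathcal P)$ is a given set of pairs $(p,q)$, $p,q\in\mathcal P$, $p\ne q$ (the allowed switches from $p$ to $q$). Admissible signals. $\mathcal S_{\mathcal R}$ is the set of switching signals such that $(\sigma(\tau_i),\sigma(\tau_{i+1}))\in E(\mathcal P)$ and $\tau_{i+1}-\tau_i\in[\delta,\Delta]$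 for $i=0,1,2,\dots$. Given $\check\delta,\hat\Delta\in[\delta,\Delta]$, $\mathcal S'_{\mathcal R}$ is the set of all $\sigma\in\mathcal S_{\mathcal R}$ such that for all $i=0,1,2,\dots$: (C1) $\sigma(\tau_i)\in\mathcal P_U$ and $\sigma(\tau_{i+1})\in\mathcal P_U$ do not both hold; (C2) $\tau_{i+1}-\tau_i\in[\check\delta,\Delta]$ whenever $\sigma(\tau_i)\in\mathcal P_S$; (C3) $\tau_{i+1}-\tau_i\in[\delta,\hat\Delta]$ whenever $\sigma(\tau_i)\in\mathcal P_U$. IOSS. The switched system is IOSS under $\sigma$ if there exist class $\mathcal K_\infty$ functions $\alpha,\chi_1,\chi_2$ and a class $\mathcal{KL}$ function $\beta$ such that for all inputs $v$ and initial states $x_0$, $$\alpha(\|x(t)\|)\le\beta(\|x_0\|,t)+\chi_1(\|v\|_{[0,t]})+\chi_2(\|y\|_{[0,t]})$$ for all $t\ge0$ (for which the solution is defined). *)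

theory Defs
  imports "HOL-Analysis.Analysis" "HOL-Probability.Essential_Supremum"
begin

(* Comparison functions act on [0, \<infinity>[; their values at negative reals are irrelevant. *)

definition class_K :: "(real \<Rightarrow> real) \<Rightarrow> bool" where
  "class_K \<alpha> \<longleftrightarrow> continuous_on {0..} \<alpha> \<and> strict_mono_on {0..} \<alpha> \<and> \<alpha> 0 = 0"

definition class_Kinf :: "(real \<Rightarrow> real) \<Rightarrow> bool" where
  "class_Kinf \<alpha> \<longleftrightarrow> class_K \<alpha> \<and> filterlim \<alpha> at_top at_top"

definition class_KL :: "(real \<Rightarrow> real \<Rightarrow> real) \<Rightarrow> bool" where
  "class_KL \<beta> \<longleftrightarrow>
     continuous_on ({0..} \<times> {0..}) (\<lambda>(r, t). \<beta> r t) \<and>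
     (\<forall>t\<ge>0. class_K (\<lambda>r. \<beta> r t)) \<and>
     (\<forall>r\<ge>0. antimono_on {0..} (\<beta> r) \<and> (\<beta> r \<longlongrightarrow> 0) at_top)"

definition locally_lipschitz :: "('a::metric_space \<Rightarrow> 'b::metric_space) \<Rightarrow> bool" where
  "locally_lipschitz g \<longleftrightarrow> (\<forall>z. \<exists>u>0. \<exists>L. L-lipschitz_on (ball z u) g)"

definition cont_differentiable :: "('a::real_normed_vector \<Rightarrow> 'b::real_normed_vector) \<Rightarrow> bool" where
  "cont_differentiable g \<longleftrightarrow>
     (\<exists>g'. (\<forall>x. (g has_derivative blinfun_apply (g' x)) (at x)) \<and> continuous_on UNIV g')"

(* The essential supremum of the norm of w over I, with value \<infinity> allowed. *)
definition ess_sup :: "real set \<Rightarrow> (real \<Rightarrow> 'a::real_normed_vector) \<Rightarrow> ennreal" where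
  "ess_sup I w = esssup (lebesgue_on I) (\<lambda>s. ennreal (norm (w s)))"

(* enn2real sends \<infinity> to 0, so this is meaningful only for measurable w that are essentially
   bounded on I.  It is applied to inputs (essentially bounded by definition) and to outputs along
   solutions on compact intervals [0, t] (measurable and bounded there, since solutions and the
   output maps are continuous and the switching signal is piecewise constant).
   On the null set [0, 0] its value is 0. *)
definition ess_norm :: "real set \<Rightarrow> (real \<Rightarrow> 'a::real_normed_vector) \<Rightarrow> real" where
  "ess_norm I w = enn2real (ess_sup I w)"

definition is_input :: "(real \<Rightarrow> 'a::euclidean_space) \<Rightarrow> bool" where
  "is_input v \<longleftrightarrow> v \<in> borel_measurable (lebesgue_on {0..}) \<and> ess_sup {0..} v < \<infinity>"

(* D division_of \<Union>D says that D is a finite family of nonempty compact intervals with pairwise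
   disjoint interiors. *)
definition abs_cont_on :: "real \<Rightarrow> real \<Rightarrow> (real \<Rightarrow> 'a::real_normed_vector) \<Rightarrow> bool" where
  "abs_cont_on a b g \<longleftrightarrow>
     (\<forall>\<epsilon>>0. \<exists>\<eta>>0. \<forall>D. D division_of \<Union>D \<and> \<Union>D \<subseteq> {a..b} \<and> (\<Sum>k\<in>D. Sup k - Inf k) < \<eta> \<longrightarrow>
        (\<Sum>k\<in>D. norm (g (Sup k) - g (Inf k))) < \<epsilon>)"

(* Signals are functions on all of real, but only their values on [0, \<infinity>[ are used. *)

definition jumps :: "(real \<Rightarrow> nat) \<Rightarrow> real set" where
  "jumps \<sigma> = {t. 0 < t \<and> \<not> isCont \<sigma> t}"

(* The topology of nat is discrete, so continuity of \<sigma> at a point means being constant near it.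
   A signal with finitely many jumps in each bounded interval is thus constant between
   consecutive jumps. *)
definition switching_signal :: "nat set \<Rightarrow> (real \<Rightarrow> nat) \<Rightarrow> bool" where
  "switching_signal P \<sigma> \<longleftrightarrow>
     (\<forall>t\<ge>0. \<sigma> t \<in> P) \<and>
     (\<forall>T. finite (jumps \<sigma> \<inter> {..T})) \<and>
     (\<forall>t\<ge>0. continuous (at_right t) \<sigma>) \<and>
     (\<forall>t>0. \<exists>l. (\<sigma> \<longlongrightarrow> l) (at_left t))"

(* \<tau> enumerates increasingly the initial time 0 and the jumps of \<sigma>; for a given \<sigma> there is
   at most one such \<tau>. *)
definition switching_instants :: "(real \<Rightarrow> nat) \<Rightarrow> (nat \<Rightarrow> real) \<Rightarrow> bool" where
  "switching_instants \<sigma> \<tau> \<longleftrightarrow> \<tau> 0 = 0 \<and> strict_mono \<tau> \<and> range \<tau> = insert 0 (jumps \<sigma>)"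

definition S_R :: "nat set \<Rightarrow> (nat \<times> nat) set \<Rightarrow> real \<Rightarrow> real \<Rightarrow> (real \<Rightarrow> nat) set" where
  "S_R P E \<delta> \<Delta> = {\<sigma>. switching_signal P \<sigma> \<and>
     (\<exists>\<tau>. switching_instants \<sigma> \<tau> \<and>
        (\<forall>i. (\<sigma> (\<tau> i), \<sigma> (\<tau> (Suc i))) \<in> E \<and> \<tau> (Suc i) - \<tau> i \<in> {\<delta>..\<Delta>}))}"

definition S_R' ::
  "nat set \<Rightarrow> nat set \<Rightarrow> (nat \<times> nat) set \<Rightarrow> real \<Rightarrow> real \<Rightarrow> real \<Rightarrow> real \<Rightarrow> (real \<Rightarrow> nat) set" where
  "S_R' PS PU E \<delta> \<Delta> \<delta>c \<Delta>h = {\<sigma> \<in> S_R (PS \<union> PU) E \<delta> \<Delta>.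
     \<exists>\<tau>. switching_instants \<sigma> \<tau> \<and>
       (\<forall>i. \<not> (\<sigma> (\<tau> i) \<in> PU \<and> \<sigma> (\<tau> (Suc i)) \<in> PU) \<and>
            (\<sigma> (\<tau> i) \<in> PS \<longrightarrow> \<tau> (Suc i) - \<tau> i \<in> {\<delta>c..\<Delta>}) \<and>
            (\<sigma> (\<tau> i) \<in> PU \<longrightarrow> \<tau> (Suc i) - \<tau> i \<in> {\<delta>..\<Delta>h}))}"

(* I is any interval [0, T], [0, T[ or [0, \<infinity>[ on which the solution is defined. *)
definition caratheodory_solution ::
  "(nat \<Rightarrow> 'x::euclidean_space \<times> 'u::euclidean_space \<Rightarrow> 'x) \<Rightarrow> (real \<Rightarrow> nat) \<Rightarrow> (real \<Rightarrow> 'u) \<Rightarrow>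
   'x \<Rightarrow> real set \<Rightarrow> (real \<Rightarrow> 'x) \<Rightarrow> bool" where
  "caratheodory_solution f \<sigma> v x0 I x \<longleftrightarrow>
     is_interval I \<and> 0 \<in> I \<and> I \<subseteq> {0..} \<and> x 0 = x0 \<and>
     (\<forall>t\<in>I. abs_cont_on 0 t x) \<and>
     (AE t in lebesgue_on I. (x has_vector_derivative f (\<sigma> t) (x t, v t)) (at t within I))"

definition IOSS ::
  "(nat \<Rightarrow> 'x::euclidean_space \<times> 'u::euclidean_space \<Rightarrow> 'x) \<Rightarrow>
   (nat \<Rightarrow> 'x \<Rightarrow> 'y::euclidean_space) \<Rightarrow> (real \<Rightarrow> nat) \<Rightarrow> bool" where
  "IOSS f h \<sigma> \<longleftrightarrow>
     (\<exists>\<alpha> \<chi>\<^sub>1 \<chi>\<^sub>2 \<beta>. class_Kinf \<alpha> \<and> class_Kinf \<chi>\<^sub>1 \<and> class_Kinf \<chi>\<^sub>2 \<and> class_KL \<beta> \<and>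
       (\<forall>v x0 I x. is_input v \<and> caratheodory_solution f \<sigma> v x0 I x \<longrightarrow>
          (\<forall>t\<in>I. \<alpha> (norm (x t)) \<le> \<beta> (norm x0) t + \<chi>\<^sub>1 (ess_norm {0..t} v)
                      + \<chi>\<^sub>2 (ess_norm {0..t} (\<lambda>s. h (\<sigma> s) (x s))))))"

end

theory Submission
  imports Defs
begin

text \<open>On a mode with \<open>V' \<le> c * V + G\<close> the function
  \<open>exp (\<theta> t) * V (x t)\<close> with \<open>\<theta>' = - c - \<kappa>\<close> decays at rate \<open>\<kappa>\<close> up to the
  input term.  The exponent \<open>\<theta>\<close> rises with slope \<open>lam_s - \<kappa>\<close> from 0 on stable modes and falls with
  slope \<open>lam_u + \<kappa>\<close> to \<open>ln \<mu>\<close> on unstable ones.  Assumption (A4) gives a \<open>\<kappa> > 0\<close> with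
  \<open>(lam_s - \<kappa>) * \<delta>c = 2 * ln \<mu> + (lam_u + \<kappa>) * \<Delta>h\<close>, so \<open>\<theta>\<close> can drop by \<open>ln \<mu>\<close> at every switch, which
  absorbs the factor \<open>\<mu>\<close>; as dwell times are at most \<open>\<Delta>\<close>, \<open>\<theta>\<close> stays bounded.  Hence the weighted
  Lyapunov function decays exponentially along the whole trajectory.\<close>

section \<open>Absolutely continuous functions\<close>

lemma abs_cont_on_subinterval:
  assumes "abs_cont_on a b g" "a \<le> c" "d \<le> b"
  shows "abs_cont_on c d g"
  unfolding abs_cont_on_def
proof (intro allI impI)
  fix \<epsilon> :: real assume "\<epsilon> > 0"
  then obtain \<eta> where "\<eta> > 0" and \<eta>: "\<And>D. D division_of \<Union>D \<Longrightarrow> \<Union>D \<subseteq> {a..b} \<Longrightarrow>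
      (\<Sum>k\<in>D. Sup k - Inf k) < \<eta> \<Longrightarrow> (\<Sum>k\<in>D. norm (g (Sup k) - g (Inf k))) < \<epsilon>"
    using assms(1) unfolding abs_cont_on_def by meson
  have "{c..d} \<subseteq> {a..b}" using assms by auto
  then show "\<exists>\<eta>>0. \<forall>D. D division_of \<Union>D \<and> \<Union>D \<subseteq> {c..d} \<and> (\<Sum>k\<in>D. Sup k - Inf k) < \<eta> \<longrightarrow>
      (\<Sum>k\<in>D. norm (g (Sup k) - g (Inf k))) < \<epsilon>"
    using \<open>\<eta> > 0\<close> \<eta> by (meson order_trans)
qed

lemma division_real_interval:
  assumes "D division_of S" "k \<in> D"
  obtains u v :: real where "k = {u..v}" "u \<le> v" "Inf k = u" "Sup k = v" "u \<in> S" "v \<in> S"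
proof -
  obtain u v where uv: "k = {u..v}" using division_ofD(4)[OF assms] by auto
  moreover have "k \<noteq> {}" "k \<subseteq> S" using division_ofD(2,3)[OF assms] by auto
  ultimately have "u \<le> v" "u \<in> S" "v \<in> S" by auto
  with uv show ?thesis using that by simp
qed

lemma abs_cont_on_dominated:
  fixes x :: "real \<Rightarrow> 'a::real_normed_vector" and g :: "real \<Rightarrow> 'b::real_normed_vector"
  assumes x: "abs_cont_on a b x" and "0 < L"
    and L: "\<And>u v. u \<in> {a..b} \<Longrightarrow> v \<in> {a..b} \<Longrightarrow> norm (g v - g u) \<le> L * (norm (x v - x u) + \<bar>v - u\<bar>)"
  shows "abs_cont_on a b g"
  unfolding abs_cont_on_def
proof (intro allI impI)
  fix \<epsilon> :: real assume "\<epsilon> > 0"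
  define e where "e = \<epsilon> / (2 * L)"
  have "e > 0" using \<open>\<epsilon> > 0\<close> \<open>0 < L\<close> by (simp add: e_def)
  then obtain \<eta> where "\<eta> > 0" and \<eta>: "\<And>D. D division_of \<Union>D \<Longrightarrow> \<Union>D \<subseteq> {a..b} \<Longrightarrow>
      (\<Sum>k\<in>D. Sup k - Inf k) < \<eta> \<Longrightarrow> (\<Sum>k\<in>D. norm (x (Sup k) - x (Inf k))) < e"
    using x unfolding abs_cont_on_def by meson
  show "\<exists>\<eta>>0. \<forall>D. D division_of \<Union>D \<and> \<Union>D \<subseteq> {a..b} \<and> (\<Sum>k\<in>D. Sup k - Inf k) < \<eta> \<longrightarrow>
      (\<Sum>k\<in>D. norm (g (Sup k) - g (Inf k))) < \<epsilon>"
  proof (intro exI[of _ "min \<eta> e"] conjI allI impI)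
    show "min \<eta> e > 0" using \<open>\<eta> > 0\<close> \<open>e > 0\<close> by simp
    fix D assume "D division_of \<Union>D \<and> \<Union>D \<subseteq> {a..b} \<and> (\<Sum>k\<in>D. Sup k - Inf k) < min \<eta> e"
    then have D: "D division_of \<Union>D" "\<Union>D \<subseteq> {a..b}" "(\<Sum>k\<in>D. Sup k - Inf k) < \<eta>"
      "(\<Sum>k\<in>D. Sup k - Inf k) < e" by auto
    have "(\<Sum>k\<in>D. norm (g (Sup k) - g (Inf k)))
        \<le> (\<Sum>k\<in>D. L * (norm (x (Sup k) - x (Inf k)) + (Sup k - Inf k)))"
    proof (rule sum_mono)
      fix k assume "k \<in> D"
      then obtain u v where "u \<le> v" "Inf k = u" "Sup k = v" "u \<in> \<Union>D" "v \<in> \<Union>D"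
        using division_real_interval[OF D(1)] by metis
      moreover from this have "u \<in> {a..b}" "v \<in> {a..b}" using D(2) by auto
      ultimately show "norm (g (Sup k) - g (Inf k))
          \<le> L * (norm (x (Sup k) - x (Inf k)) + (Sup k - Inf k))"
        using L[of u v] by simp
    qed
    also have "\<dots> = L * ((\<Sum>k\<in>D. norm (x (Sup k) - x (Inf k))) + (\<Sum>k\<in>D. Sup k - Inf k))"
      by (simp only: sum_distrib_left[symmetric] sum.distrib)
    also have "\<dots> < L * (e + e)"
      using \<eta>[OF D(1,2,3)] D(4) \<open>0 < L\<close> by (intro mult_strict_left_mono) auto
    also have "\<dots> = \<epsilon>" using \<open>0 < L\<close> by (simp add: e_def)
    finally show "(\<Sum>k\<in>D. norm (g (Sup k) - g (Inf k))) < \<epsilon>" .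
  qed
qed

lemma abs_cont_on_imp_continuous_on:
  assumes "abs_cont_on a b g"
  shows "continuous_on {a..b} g"
  unfolding continuous_on_iff
proof (intro ballI allI impI)
  fix s \<epsilon> :: real assume s: "s \<in> {a..b}" and "\<epsilon> > 0"
  then obtain \<eta> where "\<eta> > 0" and \<eta>: "\<And>D. D division_of \<Union>D \<Longrightarrow> \<Union>D \<subseteq> {a..b} \<Longrightarrow>
      (\<Sum>k\<in>D. Sup k - Inf k) < \<eta> \<Longrightarrow> (\<Sum>k\<in>D. norm (g (Sup k) - g (Inf k))) < \<epsilon>"
    using assms unfolding abs_cont_on_def by meson
  have *: "dist (g v) (g u) < \<epsilon>" if "u \<le> v" "u \<in> {a..b}" "v \<in> {a..b}" "v - u < \<eta>" for u v
  proof -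
    have "{{u..v}} division_of \<Union>{{u..v}}"
      using division_of_self[of u v] that(1) by simp
    from \<eta>[OF this] show ?thesis using that by (simp add: dist_norm)
  qed
  show "\<exists>d>0. \<forall>t\<in>{a..b}. dist t s < d \<longrightarrow> dist (g t) (g s) < \<epsilon>"
  proof (intro exI[of _ \<eta>] conjI ballI impI)
    fix t assume t: "t \<in> {a..b}" "dist t s < \<eta>"
    show "dist (g t) (g s) < \<epsilon>"
    proof (cases "s \<le> t")
      case True then show ?thesis using * [of s t] s t by (simp add: dist_real_def)
    next
      case False then show ?thesis using * [of t s] s t by (simp add: dist_real_def dist_commute)
    qed
  qed fact
qed

lemma real_deriv_nonpos_local_bound:
  fixes g :: "real \<Rightarrow> real"
  assumes "(g has_real_derivative D) (at s)" "D \<le> 0" "e > 0"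
  obtains d where "d > 0"
    "\<And>u v. s - d < u \<Longrightarrow> u \<le> s \<Longrightarrow> s \<le> v \<Longrightarrow> v < s + d \<Longrightarrow> g v - g u \<le> e * (v - u)"
proof -
  obtain d where "d > 0" and
    d: "\<And>y. \<bar>y - s\<bar> < d \<Longrightarrow> \<bar>g y - g s - D * (y - s)\<bar> \<le> e * \<bar>y - s\<bar>"
    using assms(1,3) unfolding has_field_derivative_def has_derivative_at_alt real_norm_def by meson
  have "g v - g u \<le> e * (v - u)" if "s - d < u" "u \<le> s" "s \<le> v" "v < s + d" for u v
  proof -
    have "\<bar>g u - g s - D * (u - s)\<bar> \<le> e * (s - u)" "\<bar>g v - g s - D * (v - s)\<bar> \<le> e * (v - s)"
      using d[of u] d[of v] that by auto
    then have "g v - g u \<le> D * (v - s) - D * (u - s) + e * (s - u) + e * (v - s)"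
      by linarith
    also have "\<dots> = D * (v - u) + e * (v - u)" by (simp add: algebra_simps)
    also have "\<dots> \<le> e * (v - u)" using that \<open>D \<le> 0\<close> by (simp add: mult_nonpos_nonneg)
    finally show ?thesis .
  qed
  with \<open>d > 0\<close> show ?thesis using that by blast
qed

text \<open>Cousin's lemma yields a tagged division whose intervals tagged outside the exceptional null
  set are controlled by the derivative and whose other intervals have small total length.\<close>

lemma abs_cont_on_deriv_nonpos_le:
  fixes g :: "real \<Rightarrow> real"
  assumes "a \<le> b" and ac: "abs_cont_on a b g"
    and deriv: "AE s in lebesgue. a < s \<and> s < b \<longrightarrow> (\<exists>D\<le>0. (g has_real_derivative D) (at s))"
  shows "g b \<le> g a"
proof (rule field_le_epsilon)
  fix e0 :: real assume "e0 > 0"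
  define e where "e = e0 / (2 * (b - a + 1))"
  have "e > 0" using \<open>e0 > 0\<close> \<open>a \<le> b\<close> by (simp add: e_def)
  have "e0 / 2 > 0" using \<open>e0 > 0\<close> by simp
  then obtain \<eta> where "\<eta> > 0" and \<eta>: "\<And>D. D division_of \<Union>D \<Longrightarrow> \<Union>D \<subseteq> {a..b} \<Longrightarrow>
      (\<Sum>k\<in>D. Sup k - Inf k) < \<eta> \<Longrightarrow> (\<Sum>k\<in>D. norm (g (Sup k) - g (Inf k))) < e0 / 2"
    using ac unfolding abs_cont_on_def by meson
  obtain N0 where N0: "N0 \<in> null_sets lebesgue"
    "{s. \<not> (a < s \<and> s < b \<longrightarrow> (\<exists>D\<le>0. (g has_real_derivative D) (at s)))} \<subseteq> N0"
    using deriv unfolding eventually_ae_filter by auto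
  define N where "N = insert a (insert b N0)"
  have N: "N \<in> null_sets lebesgue" using N0 by (simp add: N_def)
  obtain U where U: "open U" "N \<subseteq> U" "U - N \<in> lmeasurable" "emeasure lebesgue (U - N) < ennreal \<eta>"
    using sets_lebesgue_outer_open[of N \<eta>] N \<open>\<eta> > 0\<close> by auto
  have emU: "emeasure lebesgue U < ennreal \<eta>"
  proof -
    have "emeasure lebesgue (U - N) = emeasure lebesgue U"
      by (rule emeasure_Diff_null_set[OF N]) (use U in auto)
    then show ?thesis using U by simp
  qed
  have Um: "U \<in> lmeasurable" using emU U(1)
    by (intro fmeasurableI) (auto intro: less_trans)
  have mU: "measure lebesgue U < \<eta>"
    using emU Um \<open>\<eta> > 0\<close> by (simp add: emeasure_eq_measure2 ennreal_less_iff)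
  have good: "\<exists>d>0. \<forall>u v. s - d < u \<and> u \<le> s \<and> s \<le> v \<and> v < s + d \<longrightarrow> g v - g u \<le> e * (v - u)"
    if "s \<in> {a..b} - N" for s
  proof -
    have "a < s" "s < b" "s \<notin> N0" using that by (auto simp: N_def)
    then obtain D where "D \<le> 0" "(g has_real_derivative D) (at s)" using N0(2) by auto
    with real_deriv_nonpos_local_bound \<open>e > 0\<close> show ?thesis by metis
  qed
  have "\<exists>d>0. (s \<in> N \<longrightarrow> ball s d \<subseteq> U) \<and>
     (s \<in> {a..b} - N \<longrightarrow> (\<forall>u v. s - d < u \<and> u \<le> s \<and> s \<le> v \<and> v < s + d \<longrightarrow> g v - g u \<le> e * (v - u)))" for s
  proof (cases "s \<in> N")
    case True
    then obtain d where "d > 0" "ball s d \<subseteq> U" using U openE by blast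
    then show ?thesis using True by blast
  next
    case False
    show ?thesis
    proof (cases "s \<in> {a..b}")
      case True then show ?thesis using good[of s] False by blast
    next
      case out: False then show ?thesis using False by (intro exI[of _ 1]) auto
    qed
  qed
  then obtain d where d: "\<And>s. d s > 0" "\<And>s. s \<in> N \<Longrightarrow> ball s (d s) \<subseteq> U"
     "\<And>s u v. s \<in> {a..b} - N \<Longrightarrow> s - d s < u \<Longrightarrow> u \<le> s \<Longrightarrow> s \<le> v \<Longrightarrow> v < s + d s \<Longrightarrow> g v - g u \<le> e * (v - u)"
    by metis
  have "gauge (\<lambda>s. ball s (d s))" using d(1) by (simp add: gauge_def)
  then obtain p where p: "p tagged_division_of {a..b}" "(\<lambda>s. ball s (d s)) fine p"
    using fine_division_exists_real by blast
  have "finite p" using p(1) by auto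
  have piece: "\<exists>u v. k = {u..v} \<and> u \<le> s \<and> s \<le> v \<and> Inf k = u \<and> Sup k = v \<and> s \<in> {a..b} \<and>
     k \<subseteq> ball s (d s) \<and> s - d s < u \<and> v < s + d s" if sk: "(s, k) \<in> p" for s k
  proof -
    obtain u v where uv: "k = cbox u v" using tagged_division_ofD(4)[OF p(1) sk] by blast
    have "s \<in> k" "k \<subseteq> {a..b}" using tagged_division_ofD(2,3)[OF p(1) sk] by auto
    moreover have "k \<subseteq> ball s (d s)" using p(2) sk by (auto simp: fine_def)
    moreover have "u \<in> k" "v \<in> k" using \<open>s \<in> k\<close> uv by auto
    ultimately have "u \<in> ball s (d s)" "v \<in> ball s (d s)" by auto
    moreover note \<open>s \<in> k\<close> \<open>k \<subseteq> {a..b}\<close> \<open>k \<subseteq> ball s (d s)\<close>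
    ultimately show ?thesis using uv by (auto simp: dist_real_def)
  qed
  define p1 where "p1 = {z \<in> p. fst z \<in> N}"
  define p2 where "p2 = {z \<in> p. fst z \<notin> N}"
  have psplit: "p = p1 \<union> p2" "p1 \<inter> p2 = {}" "p1 \<subseteq> p" "p2 \<subseteq> p" by (auto simp: p1_def p2_def)
  have fin: "finite p1" "finite p2" using \<open>finite p\<close> psplit finite_subset by auto
  have "p tagged_partial_division_of {a..b}" using p(1) by (simp add: tagged_division_of_def)
  then have p1: "p1 tagged_partial_division_of {a..b}"
    using psplit tagged_partial_division_subset by blast
  define D where "D = snd ` p1"
  have D: "D division_of \<Union>D" unfolding D_def by (rule partial_division_of_tagged_division[OF p1])
  have Dsub: "\<Union>D \<subseteq> {a..b}" unfolding D_def using tagged_partial_division_ofD(3)[OF p1] by fastforce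
  have "\<Union>D \<subseteq> U"
  proof
    fix z assume "z \<in> \<Union>D"
    then obtain s k where sk: "(s, k) \<in> p1" "z \<in> k" by (auto simp: D_def)
    then have "(s, k) \<in> p" "s \<in> N" by (auto simp: p1_def)
    with piece[of s k] d(2)[of s] sk show "z \<in> U" by blast
  qed
  have "(\<Sum>k\<in>D. Sup k - Inf k) = (\<Sum>k\<in>D. measure lebesgue k)"
  proof (rule sum.cong)
    fix k assume "k \<in> D"
    then obtain u v where "k = {u..v}" "u \<le> v" "Inf k = u" "Sup k = v"
      using division_real_interval[OF D] by metis
    then show "Sup k - Inf k = measure lebesgue k" by simp
  qed simp
  also have "\<dots> = measure lebesgue (\<Union>D)" by (rule content_division[OF D])
  also have "\<dots> \<le> measure lebesgue U"
    using \<open>\<Union>D \<subseteq> U\<close> Um lmeasurable_division[OF D] by (intro measure_mono_fmeasurable) auto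
  finally have Dlen: "(\<Sum>k\<in>D. Sup k - Inf k) < \<eta>" using mU by simp
  have "(\<Sum>(s,k)\<in>p1. g (Sup k) - g (Inf k)) \<le> (\<Sum>(s,k)\<in>p1. norm (g (Sup k) - g (Inf k)))"
    by (intro sum_mono) auto
  also have "\<dots> = (\<Sum>(s,k)\<in>p1. if k = {} then 0 else norm (g (Sup k) - g (Inf k)))"
  proof (intro sum.cong refl, clarify)
    fix s k assume "(s, k) \<in> p1"
    then have "s \<in> k" by (rule tagged_partial_division_ofD(2)[OF p1])
    then show "norm (g (Sup k) - g (Inf k)) = (if k = {} then 0 else norm (g (Sup k) - g (Inf k)))"
      by auto
  qed
  also have "\<dots> = (\<Sum>k\<in>D. if k = {} then 0 else norm (g (Sup k) - g (Inf k)))"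
    unfolding D_def
  proof (rule sum.over_tagged_division_lemma[OF tagged_partial_division_of_Union_self[OF p1]])
    fix u v :: real assume "box u v = {}"
    then have "cbox u v = {} \<or> u = v" by auto
    then show "(if cbox u v = {} then 0 else norm (g (Sup (cbox u v)) - g (Inf (cbox u v)))) = 0"
      by auto
  qed
  also have "\<dots> = (\<Sum>k\<in>D. norm (g (Sup k) - g (Inf k)))"
    using division_ofD(3)[OF D] by (intro sum.cong) auto
  also have "\<dots> < e0 / 2" by (rule \<eta>[OF D Dsub Dlen])
  finally have s1: "(\<Sum>(s,k)\<in>p1. g (Sup k) - g (Inf k)) < e0 / 2" .
  have "(\<Sum>(s,k)\<in>p2. g (Sup k) - g (Inf k)) \<le> (\<Sum>(s,k)\<in>p2. e * (Sup k - Inf k))"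
  proof (intro sum_mono, clarify)
    fix s k assume sk: "(s, k) \<in> p2"
    then have "(s, k) \<in> p" "s \<notin> N" by (auto simp: p2_def)
    with piece[of s k] d(3)[of s "Inf k" "Sup k"]
    show "g (Sup k) - g (Inf k) \<le> e * (Sup k - Inf k)" by auto
  qed
  also have "\<dots> \<le> (\<Sum>(s,k)\<in>p. e * (Sup k - Inf k))"
  proof (rule sum_mono2[OF \<open>finite p\<close> psplit(4)])
    fix z assume "z \<in> p - p2"
    then show "0 \<le> (case z of (s, k) \<Rightarrow> e * (Sup k - Inf k))"
      using piece[of "fst z" "snd z"] \<open>e > 0\<close> by (auto simp: split_beta)
  qed
  also have "\<dots> = e * (\<Sum>(s,k)\<in>p. Sup k - Inf k)" by (simp add: sum_distrib_left split_beta)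
  also have "(\<Sum>(s,k)\<in>p. Sup k - Inf k) = b - a"
    using additive_tagged_division_1[OF \<open>a \<le> b\<close> p(1), of "\<lambda>x. x"] by simp
  also have "e * (b - a) \<le> e0 / 2"
    using \<open>e0 > 0\<close> \<open>a \<le> b\<close> by (simp add: e_def field_simps)
  finally have s2: "(\<Sum>(s,k)\<in>p2. g (Sup k) - g (Inf k)) \<le> e0 / 2" .
  have "g b - g a = (\<Sum>(s,k)\<in>p. g (Sup k) - g (Inf k))"
    using additive_tagged_division_1[OF \<open>a \<le> b\<close> p(1), of g] by simp
  also have "\<dots> = (\<Sum>(s,k)\<in>p1. g (Sup k) - g (Inf k)) + (\<Sum>(s,k)\<in>p2. g (Sup k) - g (Inf k))"
    using sum.union_disjoint[OF fin psplit(2)] psplit(1) by simp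
  finally show "g b \<le> g a + e0" using s1 s2 by linarith
qed

lemma cont_differentiable_lipschitz_on_cball:
  fixes g :: "'a::euclidean_space \<Rightarrow> 'b::real_normed_vector"
  assumes "cont_differentiable g"
  obtains L where "L > 0"
    "\<And>u v. norm u \<le> R \<Longrightarrow> norm v \<le> R \<Longrightarrow> norm (g v - g u) \<le> L * norm (v - u)"
proof -
  obtain g' where g': "\<And>x. (g has_derivative blinfun_apply (g' x)) (at x)" "continuous_on UNIV g'"
    using assms unfolding cont_differentiable_def by blast
  have "compact (g' ` cball 0 R)"
    by (intro compact_continuous_image continuous_on_subset[OF g'(2)]) auto
  then obtain B where B: "B > 0" "\<And>x. x \<in> cball 0 R \<Longrightarrow> norm (g' x) \<le> B"
    using compact_imp_bounded bounded_pos by (metis imageI)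
  have "norm (g v - g u) \<le> B * norm (v - u)" if "norm u \<le> R" "norm v \<le> R" for u v
  proof (rule differentiable_bound[of "cball 0 R"])
    fix x :: 'a assume "x \<in> cball 0 R"
    then show "onorm (blinfun_apply (g' x)) \<le> B" using B(2) by (simp add: norm_blinfun.rep_eq)
    show "(g has_derivative blinfun_apply (g' x)) (at x within cball 0 R)"
      using g'(1) has_derivative_at_withinI by blast
  qed (use that in auto)
  with B(1) that show ?thesis by blast
qed

section \<open>Lyapunov functions along switched trajectories\<close>

lemma exp_affine_bounds:
  fixes a b m c :: real
  obtains B where "B > 0" "\<And>s. s \<in> {a..b} \<Longrightarrow> exp (m + c * s) \<le> B"
    "\<And>u v. u \<in> {a..b} \<Longrightarrow> v \<in> {a..b} \<Longrightarrow> \<bar>exp (m + c * v) - exp (m + c * u)\<bar> \<le> B * \<bar>v - u\<bar>"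
proof -
  have "compact ((\<lambda>s. exp (m + c * s)) ` {a..b})"
    by (intro compact_continuous_image continuous_intros) auto
  then obtain B0 where B0: "B0 > 0" "\<And>s. s \<in> {a..b} \<Longrightarrow> norm (exp (m + c * s)) \<le> B0"
    using compact_imp_bounded bounded_pos by (metis (no_types, lifting) imageI)
  define B where "B = B0 * (1 + \<bar>c\<bar>)"
  have "B0 \<le> B" "\<bar>c\<bar> * B0 \<le> B" using B0(1) by (auto simp: B_def algebra_simps abs_if)
  have "\<bar>exp (m + c * v) - exp (m + c * u)\<bar> \<le> B * \<bar>v - u\<bar>" if "u \<in> {a..b}" "v \<in> {a..b}" for u v
  proof -
    have "norm (exp (m + c * v) - exp (m + c * u)) \<le> B * norm (v - u)"
    proof (rule field_differentiable_bound[of "{a..b}"])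
      fix s assume s: "s \<in> {a..b}"
      show "((\<lambda>s. exp (m + c * s)) has_field_derivative c * exp (m + c * s)) (at s within {a..b})"
        by (auto intro!: derivative_eq_intros)
      have "\<bar>c\<bar> * exp (m + c * s) \<le> \<bar>c\<bar> * B0"
        using B0(2)[OF s] by (intro mult_left_mono) auto
      then show "norm (c * exp (m + c * s)) \<le> B"
        using \<open>\<bar>c\<bar> * B0 \<le> B\<close> by (simp add: abs_mult)
    qed (use that in auto)
    then show ?thesis by simp
  qed
  moreover have "exp (m + c * s) \<le> B" if "s \<in> {a..b}" for s
    using B0(2)[OF that] \<open>B0 \<le> B\<close> by simp
  moreover have "B > 0" using B0(1) \<open>B0 \<le> B\<close> by simp
  ultimately show ?thesis using that by blast
qed

lemma cont_differentiable_imp_differentiable: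
  "cont_differentiable g \<Longrightarrow> g differentiable (at x)"
  by (auto simp: cont_differentiable_def differentiable_def)

lemma abs_cont_on_exp_mult_comp:
  fixes x :: "real \<Rightarrow> 'a::euclidean_space" and W :: "'a \<Rightarrow> real"
  assumes x: "abs_cont_on a b x" and W: "cont_differentiable W"
  shows "abs_cont_on a b (\<lambda>s. exp (m + c * s) * W (x s) - K * exp (\<kappa> * s))"
proof -
  have contx: "continuous_on {a..b} x" by (rule abs_cont_on_imp_continuous_on[OF x])
  have "compact (x ` {a..b})" by (intro compact_continuous_image contx) auto
  then obtain R where R: "\<And>s. s \<in> {a..b} \<Longrightarrow> norm (x s) \<le> R"
    using compact_imp_bounded bounded_pos by (metis imageI)
  obtain L where L: "L > 0" "\<And>u v. norm u \<le> R \<Longrightarrow> norm v \<le> R \<Longrightarrow> norm (W v - W u) \<le> L * norm (v - u)"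
    using cont_differentiable_lipschitz_on_cball[OF W] by blast
  have "continuous_on UNIV W"
    by (intro continuous_at_imp_continuous_on ballI differentiable_imp_continuous_within
        cont_differentiable_imp_differentiable W)
  then have "continuous_on {a..b} (\<lambda>s. W (x s))"
    using continuous_on_compose2[OF _ contx] by blast
  then have "compact ((\<lambda>s. W (x s)) ` {a..b})" by (intro compact_continuous_image) auto
  then obtain Q where Q: "Q > 0" "\<And>s. s \<in> {a..b} \<Longrightarrow> \<bar>W (x s)\<bar> \<le> Q"
    using compact_imp_bounded bounded_pos by (metis (no_types, lifting) imageI real_norm_def)
  obtain B where B: "B > 0" "\<And>s. s \<in> {a..b} \<Longrightarrow> exp (m + c * s) \<le> B"
    "\<And>u v. u \<in> {a..b} \<Longrightarrow> v \<in> {a..b} \<Longrightarrow> \<bar>exp (m + c * v) - exp (m + c * u)\<bar> \<le> B * \<bar>v - u\<bar>"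
    using exp_affine_bounds[of a b m c] by metis
  obtain B' where B': "B' > 0"
    "\<And>u v. u \<in> {a..b} \<Longrightarrow> v \<in> {a..b} \<Longrightarrow> \<bar>exp (\<kappa> * v) - exp (\<kappa> * u)\<bar> \<le> B' * \<bar>v - u\<bar>"
    using exp_affine_bounds[of a b 0 \<kappa>] by (metis add_0)
  define C where "C = B * L + B * Q + \<bar>K\<bar> * B'"
  have C: "B * L \<le> C" "B * Q + \<bar>K\<bar> * B' \<le> C" "C > 0"
    using B(1) L(1) Q(1) B'(1) unfolding C_def by (auto intro!: add_pos_nonneg)
  show ?thesis
  proof (rule abs_cont_on_dominated[OF x C(3)])
    fix u v assume u: "u \<in> {a..b}" and v: "v \<in> {a..b}"
    let ?e = "\<lambda>s. exp (m + c * s)"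
    have "(?e v * W (x v) - K * exp (\<kappa> * v)) - (?e u * W (x u) - K * exp (\<kappa> * u))
       = ?e v * (W (x v) - W (x u)) + (?e v - ?e u) * W (x u) - K * (exp (\<kappa> * v) - exp (\<kappa> * u))"
      by (simp add: algebra_simps)
    also have "norm \<dots> \<le> \<bar>?e v * (W (x v) - W (x u))\<bar> + \<bar>(?e v - ?e u) * W (x u)\<bar>
        + \<bar>K * (exp (\<kappa> * v) - exp (\<kappa> * u))\<bar>"
      unfolding real_norm_def by linarith
    also have "\<bar>?e v * (W (x v) - W (x u))\<bar> \<le> B * (L * norm (x v - x u))"
      unfolding abs_mult using B(2)[OF v] L(2)[OF R[OF u] R[OF v]] B(1)
      by (intro mult_mono) auto
    also have "\<bar>(?e v - ?e u) * W (x u)\<bar> \<le> (B * \<bar>v - u\<bar>) * Q"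
      unfolding abs_mult using B(3)[OF u v] Q(2)[OF u] B(1) by (intro mult_mono) auto
    also have "\<bar>K * (exp (\<kappa> * v) - exp (\<kappa> * u))\<bar> \<le> \<bar>K\<bar> * (B' * \<bar>v - u\<bar>)"
      unfolding abs_mult using B'(2)[OF u v] by (intro mult_left_mono) auto
    finally have "norm ((?e v * W (x v) - K * exp (\<kappa> * v)) - (?e u * W (x u) - K * exp (\<kappa> * u)))
       \<le> (B * L) * norm (x v - x u) + (B * Q + \<bar>K\<bar> * B') * \<bar>v - u\<bar>"
      by (simp add: algebra_simps)
    also have "\<dots> \<le> C * norm (x v - x u) + C * \<bar>v - u\<bar>"
      using C by (intro add_mono mult_right_mono) auto
    finally show "norm ((?e v * W (x v) - K * exp (\<kappa> * v)) - (?e u * W (x u) - K * exp (\<kappa> * u)))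
       \<le> C * (norm (x v - x u) + \<bar>v - u\<bar>)" by (simp add: algebra_simps)
  qed
qed

lemma frechet_derivative_chain_real:
  fixes W :: "'a::real_normed_vector \<Rightarrow> real"
  assumes "W differentiable (at (x s))" "(x has_vector_derivative D) (at s)"
  shows "((\<lambda>s. W (x s)) has_real_derivative frechet_derivative W (at (x s)) D) (at s)"
proof -
  let ?W' = "frechet_derivative W (at (x s))"
  have W': "(W has_derivative ?W') (at (x s))"
    using assms(1) frechet_derivative_works by blast
  have "((W \<circ> x) has_derivative ?W' \<circ> (\<lambda>h. h *\<^sub>R D)) (at s)"
    using assms(2) W' unfolding has_vector_derivative_def by (rule diff_chain_at)
  moreover have "?W' \<circ> (\<lambda>h. h *\<^sub>R D) = (*) (?W' D)"
    using linear_cmul[OF has_derivative_linear[OF W']] by (auto simp: fun_eq_iff)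
  ultimately show ?thesis by (simp add: has_field_derivative_def comp_def)
qed

lemma weighted_lyapunov_decrease:
  fixes x :: "real \<Rightarrow> 'a::euclidean_space" and W :: "'a \<Rightarrow> real"
  assumes "a \<le> b" and x: "abs_cont_on a b x" and W: "cont_differentiable W"
    and deriv: "AE s in lebesgue. a < s \<and> s < b \<longrightarrow> (\<exists>D. (x has_vector_derivative D) (at s) \<and>
        frechet_derivative W (at (x s)) D \<le> c * W (x s) + G)"
    and K: "\<And>s. s \<in> {a..b} \<Longrightarrow> exp (m - (c + \<kappa>) * s) * G \<le> \<kappa> * K"
  shows "exp (\<kappa> * b) * (exp (m - (c + \<kappa>) * b) * W (x b) - K)
       \<le> exp (\<kappa> * a) * (exp (m - (c + \<kappa>) * a) * W (x a) - K)"
proof -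
  define g where "g = (\<lambda>s. exp (m + (- c) * s) * W (x s) - K * exp (\<kappa> * s))"
  have exp_split: "exp (m + (- c) * s) = exp (\<kappa> * s) * exp (m - (c + \<kappa>) * s)" for s
    by (simp add: exp_add[symmetric] algebra_simps)
  have "g b \<le> g a"
  proof (rule abs_cont_on_deriv_nonpos_le[OF \<open>a \<le> b\<close>])
    show "abs_cont_on a b g"
      unfolding g_def by (rule abs_cont_on_exp_mult_comp[OF x W])
    show "AE s in lebesgue. a < s \<and> s < b \<longrightarrow> (\<exists>D\<le>0. (g has_real_derivative D) (at s))"
      using deriv
    proof (rule AE_mp, intro AE_I2 impI)
      fix s assume "a < s \<and> s < b \<longrightarrow> (\<exists>D. (x has_vector_derivative D) (at s) \<and>
        frechet_derivative W (at (x s)) D \<le> c * W (x s) + G)" and s: "a < s \<and> s < b"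
      then obtain D where D: "(x has_vector_derivative D) (at s)"
        "frechet_derivative W (at (x s)) D \<le> c * W (x s) + G" by blast
      let ?w = "frechet_derivative W (at (x s)) D" and ?e = "exp (m + (- c) * s)"
      have "(g has_real_derivative - c * ?e * W (x s) + ?w * ?e - K * (exp (\<kappa> * s) * \<kappa>)) (at s)"
        unfolding g_def
        by (rule derivative_eq_intros refl frechet_derivative_chain_real D(1)
            cont_differentiable_imp_differentiable W | simp)+
      moreover have "- c * ?e * W (x s) + ?w * ?e - K * (exp (\<kappa> * s) * \<kappa>) \<le> 0"
      proof -
        have "?w * ?e \<le> (c * W (x s) + G) * ?e" using D(2) by (intro mult_right_mono) auto
        then have "- c * ?e * W (x s) + ?w * ?e - K * (exp (\<kappa> * s) * \<kappa>)
           \<le> ?e * G - K * (exp (\<kappa> * s) * \<kappa>)" by (simp add: algebra_simps)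
        also have "\<dots> = exp (\<kappa> * s) * (exp (m - (c + \<kappa>) * s) * G - \<kappa> * K)"
          unfolding exp_split by (simp add: algebra_simps)
        also have "\<dots> \<le> 0" using K[of s] s by (intro mult_nonneg_nonpos) auto
        finally show ?thesis .
      qed
      ultimately show "\<exists>D\<le>0. (g has_real_derivative D) (at s)" by blast
    qed
  qed
  then show ?thesis unfolding g_def exp_split by (simp add: algebra_simps)
qed

lemma switched_lyapunov_bound:
  fixes x :: "real \<Rightarrow> 'a::euclidean_space" and W :: "nat \<Rightarrow> 'a \<Rightarrow> real"
  assumes \<tau>: "\<tau> 0 = 0" "strict_mono \<tau>" "\<tau> n \<le> T" "T \<le> \<tau> (Suc n)"
    and x: "abs_cont_on 0 T x"
    and W: "\<And>i. cont_differentiable (W i)" "\<And>i \<xi>. 0 \<le> W i \<xi>"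
      "\<And>i \<xi>. W (Suc i) \<xi> \<le> \<mu> * W i \<xi>"
    and deriv: "AE s in lebesgue. 0 < s \<and> s < T \<longrightarrow> (\<exists>D. (x has_vector_derivative D) (at s) \<and>
        (\<forall>i. \<tau> i < s \<and> s < \<tau> (Suc i) \<longrightarrow>
          frechet_derivative (W i) (at (x s)) D \<le> c i * W i (x s) + G))"
    and \<theta>: "\<And>i s. \<tau> i \<le> s \<Longrightarrow> s \<le> \<tau> (Suc i) \<Longrightarrow> \<theta> i s = m i - (c i + \<kappa>) * s"
      "\<And>i s. \<tau> i \<le> s \<Longrightarrow> s \<le> \<tau> (Suc i) \<Longrightarrow> \<theta> i s \<in> {0..M}"
      "\<And>i. \<theta> (Suc i) (\<tau> (Suc i)) + ln \<mu> \<le> \<theta> i (\<tau> (Suc i))"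
    and "0 < \<kappa>" "0 \<le> G" "1 \<le> \<mu>"
  shows "W n (x T) \<le> exp (M - \<kappa> * T) * W 0 (x 0) + exp M / \<kappa> * G"
proof -
  define K where "K = exp M / \<kappa> * G"
  define Z where "Z i s = exp (\<kappa> * s) * (exp (\<theta> i s) * W i (x s) - K)" for i s
  have "0 \<le> K" using \<open>0 < \<kappa>\<close> \<open>0 \<le> G\<close> by (simp add: K_def)
  have \<tau>_mono: "\<tau> i \<le> \<tau> j" if "i \<le> j" for i j
    using that \<tau>(2) by (simp add: strict_mono_less_eq)
  have step: "Z i t \<le> Z i (\<tau> i)" if t: "\<tau> i \<le> t" "t \<le> \<tau> (Suc i)" "t \<le> T" for i t
  proof -
    have i0: "0 \<le> \<tau> i" using \<tau>_mono[of 0 i] \<tau>(1) by simp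
    have "exp (\<kappa> * t) * (exp (m i - (c i + \<kappa>) * t) * W i (x t) - K)
       \<le> exp (\<kappa> * \<tau> i) * (exp (m i - (c i + \<kappa>) * \<tau> i) * W i (x (\<tau> i)) - K)"
    proof (rule weighted_lyapunov_decrease[OF t(1) _ W(1), where G = G])
      show "abs_cont_on (\<tau> i) t x" using abs_cont_on_subinterval[OF x i0 t(3)] .
      show "AE s in lebesgue. \<tau> i < s \<and> s < t \<longrightarrow> (\<exists>D. (x has_vector_derivative D) (at s) \<and>
          frechet_derivative (W i) (at (x s)) D \<le> c i * W i (x s) + G)"
        using deriv
      proof (rule AE_mp, intro AE_I2 impI)
        fix s assume *: "0 < s \<and> s < T \<longrightarrow> (\<exists>D. (x has_vector_derivative D) (at s) \<and>
          (\<forall>i. \<tau> i < s \<and> s < \<tau> (Suc i) \<longrightarrow>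
            frechet_derivative (W i) (at (x s)) D \<le> c i * W i (x s) + G))" and s: "\<tau> i < s \<and> s < t"
        have "0 < s \<and> s < T" "\<tau> i < s \<and> s < \<tau> (Suc i)" using s t i0 by auto
        with * show "\<exists>D. (x has_vector_derivative D) (at s) \<and>
          frechet_derivative (W i) (at (x s)) D \<le> c i * W i (x s) + G" by blast
      qed
      fix s assume s: "s \<in> {\<tau> i..t}"
      then have "exp (m i - (c i + \<kappa>) * s) \<le> exp M"
        using \<theta>(1)[of i s] \<theta>(2)[of i s] t by auto
      then show "exp (m i - (c i + \<kappa>) * s) * G \<le> \<kappa> * K"
        using \<open>0 < \<kappa>\<close> \<open>0 \<le> G\<close> by (simp add: K_def mult_right_mono)
    qed
    then show ?thesis using \<theta>(1)[of i t] \<theta>(1)[of i "\<tau> i"] t by (simp add: Z_def)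
  qed
  have switch: "Z (Suc i) (\<tau> (Suc i)) \<le> Z i (\<tau> (Suc i))" for i
  proof -
    let ?s = "\<tau> (Suc i)"
    have "exp (\<theta> (Suc i) ?s) * W (Suc i) (x ?s) \<le> exp (\<theta> (Suc i) ?s) * (\<mu> * W i (x ?s))"
      using W(3) by (intro mult_left_mono) auto
    also have "\<dots> = exp (\<theta> (Suc i) ?s + ln \<mu>) * W i (x ?s)"
      using \<open>1 \<le> \<mu>\<close> by (simp add: exp_add)
    also have "\<dots> \<le> exp (\<theta> i ?s) * W i (x ?s)"
      using \<theta>(3)[of i] W(2) by (intro mult_right_mono) auto
    finally show ?thesis by (simp add: Z_def)
  qed
  have start: "Z i (\<tau> i) \<le> Z 0 0" if "\<tau> i \<le> T" for i
    using that
  proof (induction i)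
    case 0 then show ?case using \<tau>(1) by simp
  next
    case (Suc i)
    have "\<tau> i \<le> \<tau> (Suc i)" using \<tau>_mono by simp
    then show ?case using switch[of i] step[of i "\<tau> (Suc i)"] Suc by auto
  qed
  have "Z n T \<le> Z 0 0" using step[of n T] start[of n] \<tau>(3,4) by auto
  have "\<tau> 0 \<le> 0" "0 \<le> \<tau> (Suc 0)" using \<tau>_mono[of 0 "Suc 0"] \<tau>(1) by auto
  then have "\<theta> 0 0 \<le> M" using \<theta>(2)[of 0 0] by auto
  then have "exp (\<theta> 0 0) * W 0 (x 0) \<le> exp M * W 0 (x 0)"
    using W(2)[of 0 "x 0"] by (intro mult_right_mono) auto
  then have "Z 0 0 \<le> exp M * W 0 (x 0)"
    using \<open>0 \<le> K\<close> by (simp add: Z_def)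
  then have "exp (- (\<kappa> * T)) * Z n T \<le> exp (- (\<kappa> * T)) * (exp M * W 0 (x 0))"
    using \<open>Z n T \<le> Z 0 0\<close> by (intro mult_left_mono) auto
  then have "exp (\<theta> n T) * W n (x T) \<le> exp (M - \<kappa> * T) * W 0 (x 0) + K"
  proof -
    have "exp (- (\<kappa> * T)) * Z n T = exp (\<theta> n T) * W n (x T) - K"
      by (simp add: Z_def mult.assoc[symmetric] mult_exp_exp)
    moreover have "exp (- (\<kappa> * T)) * (exp M * W 0 (x 0)) = exp (M - \<kappa> * T) * W 0 (x 0)"
      by (simp add: mult.assoc[symmetric] mult_exp_exp)
    ultimately show ?thesis using \<open>exp (- (\<kappa> * T)) * Z n T \<le> _\<close> by linarith
  qed
  moreover have "1 * W n (x T) \<le> exp (\<theta> n T) * W n (x T)"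
    using \<theta>(2)[of n T] \<tau>(3,4) W(2) by (intro mult_right_mono) auto
  ultimately show ?thesis by (simp add: K_def)
qed

section \<open>Switching signals, essential norms and comparison functions\<close>

lemma strict_mono_same_range_eq:
  fixes f g :: "nat \<Rightarrow> 'a::linorder"
  assumes "strict_mono f" "strict_mono g" "range f = range g"
  shows "f = g"
proof
  fix n show "f n = g n"
  proof (induction n rule: less_induct)
    case (less n)
    obtain k where k: "f n = g k" using assms(3) by (metis rangeE rangeI)
    obtain l where l: "g n = f l" using assms(3) by (metis rangeE rangeI)
    have "\<not> k < n" using less k strict_mono_eq[OF assms(1)] by (metis less_irrefl)
    moreover have "\<not> l < n" using less l strict_mono_eq[OF assms(2)] by (metis less_irrefl)
    ultimately have "g n \<le> g k" "f n \<le> f l"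
      using assms(1,2) by (auto simp: strict_mono_less_eq)
    with k l have "g n \<le> f n" "f n \<le> g n" by simp_all
    then show ?case by simp
  qed
qed

lemma switching_instants_unique:
  "switching_instants \<sigma> \<tau> \<Longrightarrow> switching_instants \<sigma> \<tau>' \<Longrightarrow> \<tau> = \<tau>'"
  unfolding switching_instants_def by (intro strict_mono_same_range_eq) auto

lemma switching_signal_const_between_instants:
  assumes \<sigma>: "switching_signal P \<sigma>" and \<tau>: "switching_instants \<sigma> \<tau>"
    and s: "\<tau> i \<le> s" "s < \<tau> (Suc i)"
  shows "\<sigma> s = \<sigma> (\<tau> i)"
proof (rule connected_local_const[of "{\<tau> i..<\<tau> (Suc i)}"])
  have mono: "strict_mono \<tau>" and \<tau>0: "\<tau> 0 = 0" and range: "range \<tau> = insert 0 (jumps \<sigma>)"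
    using \<tau> by (auto simp: switching_instants_def)
  have i0: "0 \<le> \<tau> i" using strict_mono_less_eq[OF mono, of 0 i] \<tau>0 by simp
  show "\<forall>a\<in>{\<tau> i..<\<tau> (Suc i)}. \<forall>\<^sub>F b in at a within {\<tau> i..<\<tau> (Suc i)}. \<sigma> a = \<sigma> b"
  proof
    fix a assume a: "a \<in> {\<tau> i..<\<tau> (Suc i)}"
    show "\<forall>\<^sub>F b in at a within {\<tau> i..<\<tau> (Suc i)}. \<sigma> a = \<sigma> b"
    proof (cases "a = \<tau> i")
      case True
      have "(\<sigma> \<longlongrightarrow> \<sigma> a) (at_right a)"
        using \<sigma> i0 True by (auto simp: switching_signal_def continuous_within)
      then have "\<forall>\<^sub>F b in at_right a. \<sigma> b \<in> {\<sigma> a}"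
        by (rule topological_tendstoD) (auto simp: open_discrete)
      then show ?thesis using True
        by (auto simp: eventually_at_filter elim!: eventually_mono)
    next
      case False
      have "a \<notin> range \<tau>"
      proof
        assume "a \<in> range \<tau>"
        then obtain j where "a = \<tau> j" by blast
        then have "\<tau> i < \<tau> j" "\<tau> j < \<tau> (Suc i)" using a False by auto
        then have "i < j" "j < Suc i" using strict_mono_less[OF mono] by auto
        then show False by simp
      qed
      then have "isCont \<sigma> a" using range a False i0 by (auto simp: jumps_def)
      then have "(\<sigma> \<longlongrightarrow> \<sigma> a) (at a)" by (simp add: isCont_def)
      then have "\<forall>\<^sub>F b in at a. \<sigma> b \<in> {\<sigma> a}"
        by (rule topological_tendstoD) (auto simp: open_discrete)
      then show ?thesis by (auto simp: eventually_at_filter elim!: eventually_mono)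
    qed
  qed
  show "s \<in> {\<tau> i..<\<tau> (Suc i)}" "\<tau> i \<in> {\<tau> i..<\<tau> (Suc i)}" using s by auto
qed auto

lemma dwell_time_cover:
  fixes \<tau> :: "nat \<Rightarrow> real"
  assumes "\<tau> 0 = 0" "0 < \<delta>" "\<And>i. \<delta> \<le> \<tau> (Suc i) - \<tau> i" "0 \<le> s"
  shows "\<exists>i. \<tau> i \<le> s \<and> s < \<tau> (Suc i)"
proof -
  have lower: "real n * \<delta> \<le> \<tau> n" for n
  proof (induction n)
    case (Suc n) then show ?case using assms(3)[of n] by (simp add: algebra_simps)
  qed (simp add: assms)
  obtain n where "s < real n * \<delta>" using reals_Archimedean3[OF \<open>0 < \<delta>\<close>] by blast
  then have "s < \<tau> n" using lower[of n] by simp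
  then show ?thesis
  proof (induction n)
    case 0 then show ?case using assms by simp
  next
    case (Suc n) then show ?case by (cases "s < \<tau> n") (auto intro: exI[of _ n])
  qed
qed

lemma AE_norm_le_ess_norm:
  assumes "ess_sup A w < \<infinity>"
  shows "AE s in lebesgue_on A. norm (w s) \<le> ess_norm A w"
  using esssup_AE[of "\<lambda>s. ennreal (norm (w s))" "lebesgue_on A"]
proof (rule AE_mp, intro AE_I2 impI)
  fix s assume "ennreal (norm (w s)) \<le> esssup (lebesgue_on A) (\<lambda>s. ennreal (norm (w s)))"
  then have "enn2real (ennreal (norm (w s))) \<le> enn2real (ess_sup A w)"
    using assms by (intro enn2real_mono) (auto simp: ess_sup_def)
  then show "norm (w s) \<le> ess_norm A w" by (simp add: ess_norm_def)
qed

lemma ess_sup_finite_of_bound: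
  assumes "w \<in> borel_measurable (lebesgue_on A)" "AE s in lebesgue_on A. norm (w s) \<le> B"
  shows "ess_sup A w < \<infinity>"
proof -
  have "ess_sup A w \<le> ennreal B"
    unfolding ess_sup_def
  proof (rule esssup_I)
    show "AE s in lebesgue_on A. ennreal (norm (w s)) \<le> ennreal B"
      using assms(2) by (rule AE_mp) (auto intro!: AE_I2 ennreal_leI)
  qed (use assms(1) in measurable)
  then show ?thesis by (simp add: le_less_trans)
qed

lemma AE_lebesgue_on_iff:
  "A \<in> sets lebesgue \<Longrightarrow> (AE s in lebesgue_on A. Q s) \<longleftrightarrow> (AE s in lebesgue. s \<in> A \<longrightarrow> Q s)"
  by (rule AE_restrict_space_iff) simp

lemma AE_input_le_ess_norm:
  assumes "is_input v"
  shows "AE s in lebesgue. s \<in> {0..T} \<longrightarrow> norm (v s) \<le> ess_norm {0..T} v"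
proof -
  have v: "v \<in> borel_measurable (lebesgue_on {0..})" "ess_sup {0..} v < \<infinity>"
    using assms by (auto simp: is_input_def)
  have "v \<in> borel_measurable (lebesgue_on {0..T})"
    by (rule measurable_restrict_mono[OF v(1)]) auto
  moreover have "AE s in lebesgue_on {0..T}. norm (v s) \<le> ess_norm {0..} v"
    using AE_norm_le_ess_norm[OF v(2)] by (simp add: AE_lebesgue_on_iff) (erule AE_mp, auto)
  ultimately have "ess_sup {0..T} v < \<infinity>" by (rule ess_sup_finite_of_bound)
  from AE_norm_le_ess_norm[OF this] show ?thesis by (simp add: AE_lebesgue_on_iff)
qed

lemma AE_output_le_ess_norm:
  fixes x :: "real \<Rightarrow> 'a::euclidean_space" and h :: "nat \<Rightarrow> 'a \<Rightarrow> 'b::euclidean_space"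
  assumes "finite P" and h: "\<And>p. p \<in> P \<Longrightarrow> continuous_on UNIV (h p)"
    and x: "continuous_on {0..T} x"
    and \<sigma>: "\<And>s. 0 \<le> s \<Longrightarrow> \<sigma> s \<in> P"
    and cover: "\<And>s. 0 \<le> s \<Longrightarrow> \<exists>i. \<tau> i \<le> s \<and> s < \<tau> (Suc i)"
    and const: "\<And>i s. \<tau> i \<le> s \<Longrightarrow> s < \<tau> (Suc i) \<Longrightarrow> \<sigma> s = \<sigma> (\<tau> i)"
  shows "AE s in lebesgue. s \<in> {0..T} \<longrightarrow>
     norm (h (\<sigma> s) (x s)) \<le> ess_norm {0..T} (\<lambda>s. h (\<sigma> s) (x s))"
proof -
  define M where "M = lebesgue_on {0..T}"
  have hx: "continuous_on {0..T} (\<lambda>s. h p (x s))" if "p \<in> P" for p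
    using continuous_on_compose2[OF h[OF that] x] by simp
  have \<sigma>_meas: "\<sigma> \<in> measurable M (count_space UNIV)"
  proof (subst measurable_count_space_eq_countable)
    have "\<sigma> -` {p} \<inter> space M \<in> sets M" for p
    proof -
      have "\<sigma> -` {p} \<inter> {0..T} = (\<Union>i\<in>{i. \<sigma> (\<tau> i) = p}. {\<tau> i..<\<tau> (Suc i)}) \<inter> {0..T}"
        using cover const by fastforce
      also have "\<dots> \<in> sets lebesgue" by (intro sets.Int sets.countable_UN') auto
      finally show ?thesis by (simp add: M_def sets_restrict_space_iff space_restrict_space)
    qed
    then show "\<sigma> \<in> space M \<rightarrow> UNIV \<and> (\<forall>a\<in>UNIV. \<sigma> -` {a} \<inter> space M \<in> sets M)" by auto
  qed auto
  have "(\<lambda>s. (if p \<in> P then h p (x s) else 0)) \<in> borel_measurable M" for p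
    using hx[of p] by (cases "p \<in> P") (auto simp: M_def intro!: continuous_imp_measurable_on_sets_lebesgue)
  from measurable_compose_countable[OF this \<sigma>_meas]
  have "(\<lambda>s. (if \<sigma> s \<in> P then h (\<sigma> s) (x s) else 0)) \<in> borel_measurable M" .
  then have meas: "(\<lambda>s. h (\<sigma> s) (x s)) \<in> borel_measurable M"
    by (rule measurable_cong[THEN iffD1, rotated]) (auto simp: M_def space_restrict_space \<sigma>)
  have "bounded (\<Union>p\<in>P. (\<lambda>s. h p (x s)) ` {0..T})"
    using \<open>finite P\<close> hx by (intro bounded_UN ballI compact_imp_bounded compact_continuous_image) auto
  then obtain B where "\<And>z. z \<in> (\<Union>p\<in>P. (\<lambda>s. h p (x s)) ` {0..T}) \<Longrightarrow> norm z \<le> B"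
    unfolding bounded_iff by blast
  moreover have "h (\<sigma> s) (x s) \<in> (\<Union>p\<in>P. (\<lambda>s. h p (x s)) ` {0..T})" if "s \<in> {0..T}" for s
    using that by (intro UN_I[of "\<sigma> s"] \<sigma> image_eqI[of _ _ s]) auto
  ultimately have "norm (h (\<sigma> s) (x s)) \<le> B" if "s \<in> {0..T}" for s using that by blast
  then have "AE s in M. norm (h (\<sigma> s) (x s)) \<le> B"
    by (intro AE_I2) (auto simp: M_def space_restrict_space)
  from AE_norm_le_ess_norm[OF ess_sup_finite_of_bound[OF meas[unfolded M_def] this[unfolded M_def]]]
  show ?thesis by (simp add: AE_lebesgue_on_iff)
qed

lemma caratheodory_solution_AE:
  assumes "caratheodory_solution f \<sigma> v x0 I x" "T \<in> I"
  shows "AE s in lebesgue. 0 < s \<and> s < T \<longrightarrow>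
     (x has_vector_derivative f (\<sigma> s) (x s, v s)) (at s)"
proof -
  have I: "is_interval I" "0 \<in> I" using assms by (auto simp: caratheodory_solution_def)
  have sub: "{0<..<T} \<subseteq> I"
    using mem_is_interval_1_I[OF I assms(2)] by auto
  have "I \<in> sets lebesgue" using real_interval_borel_measurable[OF I(1)] by simp
  then have "AE s in lebesgue. s \<in> I \<longrightarrow> (x has_vector_derivative f (\<sigma> s) (x s, v s)) (at s within I)"
    using assms(1) by (simp add: caratheodory_solution_def AE_lebesgue_on_iff)
  then show ?thesis
  proof (rule AE_mp, intro AE_I2 impI)
    fix s assume *: "s \<in> I \<longrightarrow> (x has_vector_derivative f (\<sigma> s) (x s, v s)) (at s within I)"
      and s: "0 < s \<and> s < T"
    have "s \<in> {0<..<T}" using s by simp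
    then have "s \<in> interior I" using sub by (meson interior_maximal open_greaterThanLessThan subsetD)
    then show "(x has_vector_derivative f (\<sigma> s) (x s, v s)) (at s)"
      using * interior_subset at_within_interior by (metis subsetD)
  qed
qed

lemma class_KinfD:
  assumes "class_Kinf \<alpha>"
  shows "\<And>r s. 0 \<le> r \<Longrightarrow> r \<le> s \<Longrightarrow> \<alpha> r \<le> \<alpha> s" "\<And>r. 0 \<le> r \<Longrightarrow> 0 \<le> \<alpha> r"
proof -
  have \<alpha>: "strict_mono_on {0..} \<alpha>" "\<alpha> 0 = 0" using assms by (auto simp: class_Kinf_def class_K_def)
  show mono: "\<alpha> r \<le> \<alpha> s" if "0 \<le> r" "r \<le> s" for r s
    using that strict_mono_onD[OF \<alpha>(1), of r s] by (cases "r = s") auto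
  show "0 \<le> \<alpha> r" if "0 \<le> r" for r using mono[of 0 r] that \<alpha>(2) by simp
qed

lemma class_K_cmult:
  assumes "class_K \<alpha>" "0 < c"
  shows "class_K (\<lambda>r. c * \<alpha> r)"
  using assms by (auto simp: class_K_def strict_mono_on_def intro!: continuous_intros)

lemma class_Kinf_cmult:
  assumes "class_Kinf \<alpha>" "0 < c"
  shows "class_Kinf (\<lambda>r. c * \<alpha> r)"
  using assms class_K_cmult filterlim_tendsto_pos_mult_at_top[OF tendsto_const]
  by (auto simp: class_Kinf_def)

lemma class_KL_exp:
  assumes \<alpha>: "class_Kinf \<alpha>" and "0 < \<kappa>"
  shows "class_KL (\<lambda>r t. exp (M - \<kappa> * t) * \<alpha> r)"
  unfolding class_KL_def
proof (intro conjI allI impI)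
  have K: "class_K \<alpha>" using \<alpha> by (simp add: class_Kinf_def)
  have "continuous_on ({0..} \<times> {0..}) (\<lambda>z. \<alpha> (fst z))"
  proof (rule continuous_on_compose2[of "{0..}" \<alpha>])
    show "continuous_on {0..} \<alpha>" using K by (simp add: class_K_def)
  qed (auto intro: continuous_on_fst continuous_on_id)
  then show "continuous_on ({0..} \<times> {0..}) (\<lambda>(r, t). exp (M - \<kappa> * t) * \<alpha> r)"
    unfolding split_beta by (intro continuous_on_mult continuous_on_exp continuous_on_diff
      continuous_on_const continuous_on_snd continuous_on_id)
  show "class_K (\<lambda>r. exp (M - \<kappa> * t) * \<alpha> r)" for t using class_K_cmult[OF K] by simp
  fix r :: real assume "0 \<le> r"
  then have "0 \<le> \<alpha> r" by (rule class_KinfD(2)[OF \<alpha>])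
  then show "antimono_on {0..} (\<lambda>t. exp (M - \<kappa> * t) * \<alpha> r)"
    using \<open>0 < \<kappa>\<close> by (auto simp: monotone_on_def intro!: mult_right_mono)
  show "((\<lambda>t. exp (M - \<kappa> * t) * \<alpha> r) \<longlongrightarrow> 0) at_top"
  proof (rule tendsto_mult_left_zero)
    have "filterlim (\<lambda>t. \<kappa> * t) at_top at_top"
      using filterlim_tendsto_pos_mult_at_top[OF tendsto_const \<open>0 < \<kappa>\<close> filterlim_ident] .
    then have "filterlim (\<lambda>t. - M + \<kappa> * t) at_top at_top"
      by (rule filterlim_tendsto_add_at_top[OF tendsto_const])
    then have "filterlim (\<lambda>t. - (- M + \<kappa> * t)) at_bot at_top"
      by (rule filterlim_compose[OF filterlim_uminus_at_bot_at_top])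
    then have "filterlim (\<lambda>t. M - \<kappa> * t) at_bot at_top" by simp
    then show "((\<lambda>t. exp (M - \<kappa> * t)) \<longlongrightarrow> 0) at_top"
      by (rule filterlim_compose[OF exp_at_bot])
  qed
qed

section \<open>Input/output-to-state stability\<close>

theorem theorem1:
  fixes N :: nat and PS PU :: "nat set" and E :: "(nat \<times> nat) set"
    and f :: "nat \<Rightarrow> (real^'d) \<times> (real^'m) \<Rightarrow> real^'d"
    and h :: "nat \<Rightarrow> real^'d \<Rightarrow> real^'k"
    and V :: "nat \<Rightarrow> real^'d \<Rightarrow> real"
    and \<alpha>l \<alpha>u \<gamma>\<^sub>1 \<gamma>\<^sub>2 :: "real \<Rightarrow> real"
    and \<delta> \<Delta> \<delta>c \<Delta>h lam_s lam_u \<mu> :: real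
  assumes partition: "PS \<union> PU = {1..N}" "PS \<inter> PU = {}"
    and E: "E \<subseteq> {(p, q). p \<in> {1..N} \<and> q \<in> {1..N} \<and> p \<noteq> q}"
    and f: "\<And>p. p \<in> {1..N} \<Longrightarrow> locally_lipschitz (f p) \<and> f p (0, 0) = 0"
    and h: "\<And>p. p \<in> {1..N} \<Longrightarrow> continuous_on UNIV (h p) \<and> h p 0 = 0"
    and dwell: "0 < \<delta>" "\<delta> \<le> \<Delta>"
    and A1_K: "class_Kinf \<alpha>l" "class_Kinf \<alpha>u" "class_Kinf \<gamma>\<^sub>1" "class_Kinf \<gamma>\<^sub>2"
    and A1_pos: "0 < lam_s" "0 < lam_u"
    and A1_V: "\<And>p. p \<in> {1..N} \<Longrightarrow> cont_differentiable (V p)"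
      "\<And>p \<xi>. p \<in> {1..N} \<Longrightarrow> 0 \<le> V p \<xi>"
      "\<And>p \<xi>. p \<in> {1..N} \<Longrightarrow> \<alpha>l (norm \<xi>) \<le> V p \<xi> \<and> V p \<xi> \<le> \<alpha>u (norm \<xi>)"
    and A1_S: "\<And>p \<xi> \<eta>. p \<in> PS \<Longrightarrow> frechet_derivative (V p) (at \<xi>) (f p (\<xi>, \<eta>))
                  \<le> - lam_s * V p \<xi> + \<gamma>\<^sub>1 (norm \<eta>) + \<gamma>\<^sub>2 (norm (h p \<xi>))"
    and A1_U: "\<And>p \<xi> \<eta>. p \<in> PU \<Longrightarrow> frechet_derivative (V p) (at \<xi>) (f p (\<xi>, \<eta>))
                  \<le> lam_u * V p \<xi> + \<gamma>\<^sub>1 (norm \<eta>) + \<gamma>\<^sub>2 (norm (h p \<xi>))"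
    and A2: "1 \<le> \<mu>" "\<And>p q \<xi>. (p, q) \<in> E \<Longrightarrow> V q \<xi> \<le> \<mu> * V p \<xi>"
    and A3: "\<And>p. p \<in> PU \<Longrightarrow> \<exists>q\<in>PS. (p, q) \<in> E"
    and A4: "\<delta>c \<in> {\<delta>..\<Delta>}" "\<Delta>h \<in> {\<delta>..\<Delta>}"
      "- lam_s * (\<delta>c / \<Delta>) + lam_s * (\<delta>c / (2 * \<delta>)) + lam_u * (\<Delta>h / (2 * \<delta>)) + ln \<mu> * (1 / \<delta>) < 0"
  shows "\<forall>\<sigma> \<in> S_R' PS PU E \<delta> \<Delta> \<delta>c \<Delta>h. IOSS f h \<sigma>"
proof
  fix \<sigma> assume \<sigma>: "\<sigma> \<in> S_R' PS PU E \<delta> \<Delta> \<delta>c \<Delta>h"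
  then have sig: "switching_signal {1..N} \<sigma>" by (simp add: S_R'_def S_R_def partition)
  obtain \<tau> where \<tau>: "switching_instants \<sigma> \<tau>"
    and no_UU: "\<And>i. \<not> (\<sigma> (\<tau> i) \<in> PU \<and> \<sigma> (\<tau> (Suc i)) \<in> PU)"
    and dwell_S: "\<And>i. \<sigma> (\<tau> i) \<in> PS \<Longrightarrow> \<tau> (Suc i) - \<tau> i \<in> {\<delta>c..\<Delta>}"
    and dwell_U: "\<And>i. \<sigma> (\<tau> i) \<in> PU \<Longrightarrow> \<tau> (Suc i) - \<tau> i \<in> {\<delta>..\<Delta>h}"
    using \<sigma> unfolding S_R'_def by blast
  obtain \<tau>' where "switching_instants \<sigma> \<tau>'"
    "\<And>i. (\<sigma> (\<tau>' i), \<sigma> (\<tau>' (Suc i))) \<in> E \<and> \<tau>' (Suc i) - \<tau>' i \<in> {\<delta>..\<Delta>}"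
    using \<sigma> unfolding S_R'_def S_R_def by blast
  moreover from this have "\<tau>' = \<tau>" using \<tau> switching_instants_unique by blast
  ultimately have edge: "\<And>i. (\<sigma> (\<tau> i), \<sigma> (\<tau> (Suc i))) \<in> E"
    and dwell_\<tau>: "\<And>i. \<tau> (Suc i) - \<tau> i \<in> {\<delta>..\<Delta>}" by auto
  have \<tau>0: "\<tau> 0 = 0" and mono: "strict_mono \<tau>" using \<tau> by (auto simp: switching_instants_def)
  have \<tau>_nonneg: "0 \<le> \<tau> i" for i using strict_mono_less_eq[OF mono, of 0 i] \<tau>0 by simp
  have \<sigma>_in: "\<sigma> s \<in> {1..N}" if "0 \<le> s" for s using sig that by (auto simp: switching_signal_def)
  have modes: "\<sigma> (\<tau> i) \<in> {1..N}" "\<sigma> (\<tau> i) \<notin> PS \<Longrightarrow> \<sigma> (\<tau> i) \<in> PU" for i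
    using \<sigma>_in[OF \<tau>_nonneg[of i]] partition(1) by blast+
  note const = switching_signal_const_between_instants[OF sig \<tau>]
  have cover: "\<exists>i. \<tau> i \<le> s \<and> s < \<tau> (Suc i)" if "0 \<le> s" for s
  proof (rule dwell_time_cover[where \<delta> = \<delta>])
    show "\<delta> \<le> \<tau> (Suc i) - \<tau> i" for i using dwell_\<tau>[of i] by simp
  qed (rule \<tau>0 dwell(1) that)+

  define \<kappa> where "\<kappa> = (lam_s * \<delta>c - 2 * ln \<mu> - lam_u * \<Delta>h) / (\<delta>c + \<Delta>h)"
  have pos: "0 < \<delta>c" "0 < \<Delta>h" "\<Delta>h \<le> \<Delta>" "0 < \<Delta>" using A4(1,2) dwell by auto
  have "0 \<le> ln \<mu>" using A2(1) by simp
  have "0 < lam_s * \<delta>c - 2 * ln \<mu> - lam_u * \<Delta>h"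
  proof -
    define P where "P = lam_s * \<delta>c * (\<delta> / \<Delta>)"
    have "P \<le> lam_s * \<delta>c * 1" unfolding P_def
      using dwell pos A1_pos by (intro mult_left_mono) auto
    moreover have "- 2 * P + lam_s * \<delta>c + lam_u * \<Delta>h + 2 * ln \<mu>
      = 2 * \<delta> * (- lam_s * (\<delta>c / \<Delta>) + lam_s * (\<delta>c / (2 * \<delta>)) + lam_u * (\<Delta>h / (2 * \<delta>))
          + ln \<mu> * (1 / \<delta>))"
      using dwell(1) pos by (simp add: P_def field_simps)
    moreover have "\<dots> < 0" using A4(3) dwell(1) by (intro mult_pos_neg) auto
    ultimately show ?thesis by argo
  qed
  then have "0 < \<kappa>" using pos by (simp add: \<kappa>_def)
  have balance: "(lam_s - \<kappa>) * \<delta>c = 2 * ln \<mu> + (lam_u + \<kappa>) * \<Delta>h"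
  proof -
    have "\<kappa> * (\<delta>c + \<Delta>h) = lam_s * \<delta>c - 2 * ln \<mu> - lam_u * \<Delta>h" using pos by (simp add: \<kappa>_def)
    then show ?thesis by (simp add: algebra_simps)
  qed
  have "0 \<le> (lam_u + \<kappa>) * \<Delta>h" using A1_pos \<open>0 < \<kappa>\<close> pos by simp
  then have "0 \<le> (lam_s - \<kappa>) * \<delta>c" using balance \<open>0 \<le> ln \<mu>\<close> by linarith
  then have "0 \<le> lam_s - \<kappa>" using pos(1) by (simp add: zero_le_mult_iff)

  define c where "c i = (if \<sigma> (\<tau> i) \<in> PS then - lam_s else lam_u)" for i
  define m where "m i = (if \<sigma> (\<tau> i) \<in> PS then - (lam_s - \<kappa>) * \<tau> i
      else ln \<mu> + (lam_u + \<kappa>) * \<tau> (Suc i))" for i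
  define \<theta> where "\<theta> i s = (if \<sigma> (\<tau> i) \<in> PS then (lam_s - \<kappa>) * (s - \<tau> i)
      else ln \<mu> + (lam_u + \<kappa>) * (\<tau> (Suc i) - s))" for i s
  define M where "M = (lam_s - \<kappa>) * \<Delta> + (ln \<mu> + (lam_u + \<kappa>) * \<Delta>)"
  have \<theta>_affine: "\<theta> i s = m i - (c i + \<kappa>) * s" for i s
    by (simp add: \<theta>_def m_def c_def algebra_simps)
  have \<theta>_bounds: "\<theta> i s \<in> {0..M}" if s: "\<tau> i \<le> s" "s \<le> \<tau> (Suc i)" for i s
  proof -
    have len: "s - \<tau> i \<le> \<Delta>" "\<tau> (Suc i) - s \<le> \<Delta>" using dwell_\<tau>[of i] s by auto
    have "(lam_s - \<kappa>) * (s - \<tau> i) \<le> (lam_s - \<kappa>) * \<Delta>"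
      using len \<open>0 \<le> lam_s - \<kappa>\<close> by (intro mult_left_mono) auto
    moreover have "(lam_u + \<kappa>) * (\<tau> (Suc i) - s) \<le> (lam_u + \<kappa>) * \<Delta>"
      using len A1_pos \<open>0 < \<kappa>\<close> by (intro mult_left_mono) auto
    moreover have "0 \<le> (lam_s - \<kappa>) * (s - \<tau> i)" "0 \<le> (lam_u + \<kappa>) * (\<tau> (Suc i) - s)"
        "0 \<le> (lam_s - \<kappa>) * \<Delta>" "0 \<le> (lam_u + \<kappa>) * \<Delta>"
      using s pos A1_pos \<open>0 < \<kappa>\<close> \<open>0 \<le> lam_s - \<kappa>\<close> by auto
    ultimately show ?thesis using \<open>0 \<le> ln \<mu>\<close> by (simp add: \<theta>_def M_def)
  qed
  have \<theta>_switch: "\<theta> (Suc i) (\<tau> (Suc i)) + ln \<mu> \<le> \<theta> i (\<tau> (Suc i))" for i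
  proof (cases "\<sigma> (\<tau> i) \<in> PS")
    case True
    then have "(lam_s - \<kappa>) * \<delta>c \<le> (lam_s - \<kappa>) * (\<tau> (Suc i) - \<tau> i)"
      using dwell_S[of i] \<open>0 \<le> lam_s - \<kappa>\<close> by (intro mult_left_mono) auto
    then have end_i: "2 * ln \<mu> + (lam_u + \<kappa>) * \<Delta>h \<le> \<theta> i (\<tau> (Suc i))"
      using True balance by (simp add: \<theta>_def)
    show ?thesis
    proof (cases "\<sigma> (\<tau> (Suc i)) \<in> PS")
      case S: True
      then show ?thesis using end_i \<open>0 \<le> ln \<mu>\<close> \<open>0 \<le> (lam_u + \<kappa>) * \<Delta>h\<close> by (simp add: \<theta>_def)
    next
      case U: False
      then have "(lam_u + \<kappa>) * (\<tau> (Suc (Suc i)) - \<tau> (Suc i)) \<le> (lam_u + \<kappa>) * \<Delta>h"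
        using dwell_U[of "Suc i"] modes(2)[of "Suc i"] A1_pos \<open>0 < \<kappa>\<close> by (intro mult_left_mono) auto
      then show ?thesis using end_i U by (simp add: \<theta>_def)
    qed
  next
    case False
    then have "\<sigma> (\<tau> (Suc i)) \<in> PS" using no_UU[of i] modes(2)[of i] modes(2)[of "Suc i"] by blast
    then show ?thesis using False by (simp add: \<theta>_def)
  qed

  define C where "C = exp M / \<kappa>"
  have "0 < C" using \<open>0 < \<kappa>\<close> by (simp add: C_def)
  show "IOSS f h \<sigma>"
    unfolding IOSS_def
  proof (rule exI[of _ \<alpha>l], rule exI[of _ "\<lambda>r. C * \<gamma>\<^sub>1 r"], rule exI[of _ "\<lambda>r. C * \<gamma>\<^sub>2 r"],
      rule exI[of _ "\<lambda>r t. exp (M - \<kappa> * t) * \<alpha>u r"], intro conjI allI impI ballI)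
    show "class_Kinf \<alpha>l" by (rule A1_K)
    show "class_Kinf (\<lambda>r. C * \<gamma>\<^sub>1 r)" "class_Kinf (\<lambda>r. C * \<gamma>\<^sub>2 r)"
      using A1_K \<open>0 < C\<close> by (auto intro: class_Kinf_cmult)
    show "class_KL (\<lambda>r t. exp (M - \<kappa> * t) * \<alpha>u r)" by (rule class_KL_exp[OF A1_K(2) \<open>0 < \<kappa>\<close>])
    fix v x0 I x T
    assume "is_input v \<and> caratheodory_solution f \<sigma> v x0 I x" and T: "T \<in> I"
    then have v: "is_input v" and sol: "caratheodory_solution f \<sigma> v x0 I x" by auto
    have "0 \<le> T" "x 0 = x0" and ac: "abs_cont_on 0 T x"
      using sol T by (auto simp: caratheodory_solution_def)
    let ?nv = "ess_norm {0..T} v" and ?ny = "ess_norm {0..T} (\<lambda>s. h (\<sigma> s) (x s))"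
    define G where "G = \<gamma>\<^sub>1 ?nv + \<gamma>\<^sub>2 ?ny"
    have "0 \<le> G" unfolding G_def
      by (intro add_nonneg_nonneg class_KinfD(2)[OF A1_K(3)] class_KinfD(2)[OF A1_K(4)]) (simp_all add: ess_norm_def)
    obtain n where n: "\<tau> n \<le> T" "T < \<tau> (Suc n)" using cover[OF \<open>0 \<le> T\<close>] by blast
    have "V (\<sigma> (\<tau> n)) (x T) \<le> exp (M - \<kappa> * T) * V (\<sigma> (\<tau> 0)) (x 0) + exp M / \<kappa> * G"
    proof (rule switched_lyapunov_bound[OF \<tau>0 mono n(1) less_imp_le[OF n(2)] ac, where \<theta> = \<theta> and m = m
          and c = c and \<mu> = \<mu> and W = "\<lambda>i. V (\<sigma> (\<tau> i))"])
      show "cont_differentiable (V (\<sigma> (\<tau> i)))" for i by (rule A1_V(1)[OF modes(1)])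
      show "0 \<le> V (\<sigma> (\<tau> i)) \<xi>" for i \<xi> by (rule A1_V(2)[OF modes(1)])
      show "V (\<sigma> (\<tau> (Suc i))) \<xi> \<le> \<mu> * V (\<sigma> (\<tau> i)) \<xi>" for i \<xi> by (rule A2(2)[OF edge])
      have "AE s in lebesgue. s \<in> {0..T} \<longrightarrow> norm (h (\<sigma> s) (x s)) \<le> ?ny"
        using h \<sigma>_in cover const
        by (intro AE_output_le_ess_norm[of "{1..N}" _ _ _ _ \<tau>] abs_cont_on_imp_continuous_on ac) auto
      with AE_input_le_ess_norm[OF v, of T] caratheodory_solution_AE[OF sol T]
      show "AE s in lebesgue. 0 < s \<and> s < T \<longrightarrow> (\<exists>D. (x has_vector_derivative D) (at s) \<and>
        (\<forall>i. \<tau> i < s \<and> s < \<tau> (Suc i) \<longrightarrow> frechet_derivative (V (\<sigma> (\<tau> i))) (at (x s)) D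
            \<le> c i * V (\<sigma> (\<tau> i)) (x s) + G))"
      proof (eventually_elim, intro impI exI conjI allI)
        fix s i
        assume nv: "s \<in> {0..T} \<longrightarrow> norm (v s) \<le> ?nv"
          and ny: "s \<in> {0..T} \<longrightarrow> norm (h (\<sigma> s) (x s)) \<le> ?ny"
          and D: "0 < s \<and> s < T \<longrightarrow> (x has_vector_derivative f (\<sigma> s) (x s, v s)) (at s)"
          and s: "0 < s \<and> s < T"
        show "(x has_vector_derivative f (\<sigma> s) (x s, v s)) (at s)" using D s by blast
        assume i: "\<tau> i < s \<and> s < \<tau> (Suc i)"
        then have \<sigma>s: "\<sigma> (\<tau> i) = \<sigma> s" using const[of i s] by simp
        have "\<gamma>\<^sub>1 (norm (v s)) + \<gamma>\<^sub>2 (norm (h (\<sigma> s) (x s))) \<le> G"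
          unfolding G_def using nv ny s by (intro add_mono class_KinfD(1)[OF A1_K(3)] class_KinfD(1)[OF A1_K(4)]) auto
        moreover have "frechet_derivative (V (\<sigma> s)) (at (x s)) (f (\<sigma> s) (x s, v s))
          \<le> c i * V (\<sigma> s) (x s) + \<gamma>\<^sub>1 (norm (v s)) + \<gamma>\<^sub>2 (norm (h (\<sigma> s) (x s)))"
          using A1_S[of "\<sigma> s"] A1_U[of "\<sigma> s"] modes(2)[of i] by (auto simp: c_def \<sigma>s)
        ultimately show "frechet_derivative (V (\<sigma> (\<tau> i))) (at (x s)) (f (\<sigma> s) (x s, v s))
            \<le> c i * V (\<sigma> (\<tau> i)) (x s) + G" by (simp add: \<sigma>s)
      qed
    qed (use \<theta>_affine \<theta>_bounds \<theta>_switch \<open>0 < \<kappa>\<close> \<open>0 \<le> G\<close> A2(1) in auto)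
    moreover have "\<alpha>l (norm (x T)) \<le> V (\<sigma> (\<tau> n)) (x T)" using A1_V(3)[OF modes(1)] by blast
    moreover have "exp (M - \<kappa> * T) * V (\<sigma> (\<tau> 0)) (x 0) \<le> exp (M - \<kappa> * T) * \<alpha>u (norm x0)"
      using A1_V(3)[OF modes(1)[of 0], of x0] \<open>x 0 = x0\<close> by (intro mult_left_mono) auto
    ultimately show "\<alpha>l (norm (x T)) \<le> exp (M - \<kappa> * T) * \<alpha>u (norm x0) + C * \<gamma>\<^sub>1 ?nv + C * \<gamma>\<^sub>2 ?ny"
      unfolding C_def[symmetric] G_def distrib_left by linarith
  qed
qed

end
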